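(* Let $\mathbf X^{(1)},\mathbf X^{(2)},\dots$ be independent random points, each uniformly distributed in $(0,1)^2$. Let $K_n=-1$ if $\mathbf X^{(n)}$ does not set a record, and otherwise let $K_n$ be the number of current records at time $n-1$ broken by $\mathbf X^{(n)}$. Then for every integer $n\ge 1$ and every integer $k\ge 0$, $$\left|\mathbb P(K_n=k)-\Big[2^{-(k+1)}n^{-1}H_n-(k-1)2^{-(k+2)}n^{-1}\Big]\right|\le \tfrac12 n^{-2},$$ where $H_n=\sum_{i=1}^n i^{-1}$.
   Context: For $x=(x_1,x_2)$ and $y=(y_1,y_2)$ in $\mathbb R^2$, write $x\prec y$ if $x_1<y_1$ and $x_2<y_2$; $x\succ y$ means $y\prec x$. The observation $\mathbf X^{(n)}$ is a (Pareto) record, or sets a record at time $n$, if $\mathbf X^{(n)}\not\succ \mathbf X^{(i)}$ for all $1\le i<n$. For $1\le j\le n$, $\mathbf X^{(j)}$ is a current record (or remaining record) at time $n$ if $\mathbf X^{(j)}\not\succ\mathbf X^{(i)}$ for all $i\in\{1,\dots,n\}$. $\mathbf X^{(n)}$ breaks (kills) $k$ records if $\mathbf X^{(n)}$ sets a record and there are precisely $k$ values $j$ with $1\le j<n$ such that $\mathbf X^{(j)}$ is a current record at time $n-1$ but not at time $n$. *)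

theory Defs
  imports "HOL-Probability.Probability"
begin

text \<open>
  The order below is strict in both coordinates; it is not the strict part of the
  componentwise order on pairs.
\<close>

definition prec :: "real \<times> real \<Rightarrow> real \<times> real \<Rightarrow> bool"  (infix "\<prec>" 50) where
  "x \<prec> y \<longleftrightarrow> fst x < fst y \<and> snd x < snd y"

abbreviation succ :: "real \<times> real \<Rightarrow> real \<times> real \<Rightarrow> bool"  (infix "\<succ>" 50) where
  "x \<succ> y \<equiv> y \<prec> x"

text \<open>Observation sequences \<open>x\<close> are indexed from 1; the value \<open>x 0\<close> is never used.\<close>

definition sets_record :: "(nat \<Rightarrow> real \<times> real) \<Rightarrow> nat \<Rightarrow> bool" where
  "sets_record x n \<longleftrightarrow> (\<forall>i\<in>{1..<n}. \<not> x n \<succ> x i)"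

definition current_record :: "(nat \<Rightarrow> real \<times> real) \<Rightarrow> nat \<Rightarrow> nat \<Rightarrow> bool" where
  "current_record x n j \<longleftrightarrow> j \<in> {1..n} \<and> (\<forall>i\<in>{1..n}. \<not> x j \<succ> x i)"

definition broken_records :: "(nat \<Rightarrow> real \<times> real) \<Rightarrow> nat \<Rightarrow> nat set" where
  "broken_records x n =
     {j \<in> {1..<n}. current_record x (n - 1) j \<and> \<not> current_record x n j}"

definition K :: "(nat \<Rightarrow> real \<times> real) \<Rightarrow> nat \<Rightarrow> int" where
  "K x n = (if sets_record x n then int (card (broken_records x n)) else -1)"

end

theory Submission
  imports Defs
begin

text \<open>
  The approximation is exact up to a term that satisfies an averaging recursion, and this
  recursion makes the term smaller than a constant over \<open>n\<close>.

  Call a point \<^emph>\<open>killing\<close> \<open>k\<close> others in a finite set of points if nothing lies below it and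
  exactly \<open>k\<close> points have it as the only point below them. The observation at time \<open>n\<close> breaks
  \<open>k\<close> records iff it kills \<open>k\<close> points among the first \<open>n\<close> (\<open>K_eq_iff\<close>). The \<open>n\<close> points
  are exchangeable, so \<open>n P(K\<^sub>n = k)\<close> is the expected number \<open>E\<^sub>n(k)\<close> of points that kill \<open>k\<close>
  others. That number depends on the set of points alone, so the points may be listed by
  increasing abscissa; the ordinates, read in this order, are still an i.i.d. sequence
  (\<open>prob_kills_exactly\<close>). The planar problem has become a problem on one sequence \<open>y\<close>.

  Reveal \<open>y\<close> entry by entry. A new entry that is the overall minimum starts a killing point
  with no victims; a new entry that is second smallest becomes a victim of the current
  minimum; any other entry changes nothing (\<open>min_kills_Suc\<close>, \<open>num_killing_Suc\<close>). The rank of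
  entry \<open>n + 1\<close> is uniform and independent of the order pattern of the first \<open>n\<close> entries
  (\<open>prob_rank\<close>, \<open>order_pattern_indep_symmetric\<close>). Hence, with \<open>q\<^sub>n(k)\<close> the probability that
  the current minimum has \<open>k\<close> victims and \<open>q\<^sub>n(-1) = 1\<close>,
  \<open>(n + 1) q\<^sub>n\<^sub>+\<^sub>1(k) = (n - 1) q\<^sub>n(k) + q\<^sub>n(k - 1)\<close> and
  \<open>(n + 1) E\<^sub>n\<^sub>+\<^sub>1(k) = (n + 1) E\<^sub>n(k) + q\<^sub>n(k - 1) - q\<^sub>n(k)\<close>.

  These recursions imply \<open>2 E\<^sub>n(k) = E\<^sub>n(k - 1) + q\<^sub>n(k) - q\<^sub>n(k - 1)\<close> for \<open>k \<ge> 1\<close>, which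
  eliminates \<open>q\<close>. The difference \<open>D\<^sub>n(k)\<close> between \<open>E\<^sub>n(k)\<close> and
  \<open>2\<^sup>-\<^sup>k\<^sup>-\<^sup>1 H\<^sub>n - (k - 1) 2\<^sup>-\<^sup>k\<^sup>-\<^sup>2\<close> then satisfies
  \<open>(n + 1) D\<^sub>n\<^sub>+\<^sub>1(k) = (n - 1) D\<^sub>n(k) + D\<^sub>n(k - 1)\<close> with \<open>D\<^sub>n(-1) = 0\<close>. The weights on the
  right add up to \<open>n\<close>, so \<open>n sup\<^sub>k |D\<^sub>n(k)|\<close> does not increase in \<open>n\<close>; at \<open>n = 1\<close> it is \<open>1/4\<close>
  (\<open>killing_recursion_bound\<close>). Dividing by \<open>n\<close> bounds the error in \<open>P(K\<^sub>n = k)\<close> by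
  \<open>1/(4 n\<^sup>2)\<close>, half of the stated bound.
\<close>

section \<open>A two-term recursion and its error bound\<close>

text \<open>
  Eliminating \<open>q\<close> leaves a recursion for the error of \<open>E\<close> whose nonnegative weights
  \<open>n - 1\<close> and \<open>1\<close> add up to \<open>n\<close>; divided by \<open>n + 1\<close>, they contract the supremum over \<open>k\<close> by
  \<open>n / (n + 1)\<close>. The constant \<open>1/4\<close> is the largest error at \<open>n = 1\<close>.
\<close>

lemma killing_recursion_bound:
  fixes q E :: "nat \<Rightarrow> nat \<Rightarrow> real"
  assumes q1: "\<And>k. q 1 k = of_bool (k = 0)"
    and E1: "\<And>k. E 1 k = of_bool (k = 0)"
    and qS: "\<And>n k. n \<ge> 1 \<Longrightarrow> real (Suc n) * q (Suc n) k =
               (real n - 1) * q n k + (if k = 0 then 1 else q n (k - 1))"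
    and ES: "\<And>n k. n \<ge> 1 \<Longrightarrow> real (Suc n) * E (Suc n) k =
               real (Suc n) * E n k + (if k = 0 then 1 else q n (k - 1)) - q n k"
    and n: "n \<ge> 1"
  shows "\<bar>E n k - (harm n / 2 ^ (k + 1) - (real k - 1) / 2 ^ (k + 2))\<bar> \<le> 1 / (4 * real n)"
proof -
  have harmS: "real (Suc m) * harm (Suc m) = real (Suc m) * harm m + 1" for m
    by (simp add: harm_Suc field_simps)
  \<comment> \<open>This relation, which the two recursions preserve, expresses the difference of values of \<open>q\<close>
    that drives the recursion for \<open>E\<close> through \<open>E\<close> itself.\<close>
  have rel: "2 * E m k = (if k = 0 then harm m else E m (k - 1) - q m (k - 1)) + q m k"
    if "m \<ge> 1" for m k
    using that
  proof (induction m arbitrary: k rule: dec_induct)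
    case base
    show ?case using q1 E1 by (auto simp: harm_expand)
  next
    case (step m)
    have IH: "real (Suc m) * (2 * E m k) =
      real (Suc m) * ((if k = 0 then harm m else E m (k - 1) - q m (k - 1)) + q m k)" for k
      using step.IH[of k] by (simp only:)
    have "real (Suc m) * (2 * E (Suc m) k) =
          real (Suc m) * ((if k = 0 then harm (Suc m) else E (Suc m) (k - 1) - q (Suc m) (k - 1)) + q (Suc m) k)"
    proof (cases k)
      case 0
      then show ?thesis
        using ES[OF step.hyps(1), of 0] qS[OF step.hyps(1), of 0] IH[of 0] harmS[of m]
        by (simp add: algebra_simps)
    next
      case (Suc l)
      show ?thesis
        using ES[OF step.hyps(1), of k] qS[OF step.hyps(1), of k] IH[of k] step.IH[of k]
          ES[OF step.hyps(1), of l] qS[OF step.hyps(1), of l] IH[of l] step.IH[of l] Suc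
        by (cases l) (simp_all add: algebra_simps)
    qed
    then show ?case by (simp del: of_nat_Suc)
  qed
  define D where "D m k = E m k - (harm m / 2 ^ (k + 1) - (real k - 1) / 2 ^ (k + 2))" for m k
  have DS: "real (Suc m) * D (Suc m) k = (real m - 1) * D m k + (if k = 0 then 0 else D m (k - 1))"
    if m: "m \<ge> 1" for m k
  proof (cases k)
    case 0
    then show ?thesis
      using ES[OF m, of 0] rel[OF m, of 0] harmS[of m]
      by (simp add: D_def algebra_simps add_divide_distrib diff_divide_distrib)
  next
    case (Suc l)
    have "real (Suc m) * E (Suc m) k = (real m - 1) * E m k + E m l"
      using ES[OF m, of k] rel[OF m, of k] Suc by (simp add: algebra_simps)
    moreover have "real (Suc m) * D (Suc m) k = real (Suc m) * E (Suc m) k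
        - ((real (Suc m) * harm (Suc m)) / 2 ^ (k + 1) - real (Suc m) * (real k - 1) / 2 ^ (k + 2))"
      by (simp add: D_def algebra_simps)
    ultimately show ?thesis
      unfolding harmS D_def Suc by (simp add: divide_simps; simp add: algebra_simps)
  qed
  have "\<bar>D m k\<bar> \<le> 1 / (4 * real m)" if "m \<ge> 1" for m k
    using that
  proof (induction m arbitrary: k rule: dec_induct)
    case base
    \<comment> \<open>The error at \<open>n = 1\<close> and \<open>k \<ge> 1\<close> is \<open>(k - 3) / 2 ^ (k + 2)\<close>.\<close>
    have pow: "\<bar>real k - 3\<bar> \<le> 2 ^ k" if "k \<ge> 1"
    proof -
      have "real k \<le> 2 ^ k" using of_nat_less_two_power[of k, where 'a=real] by simp
      moreover have "(2::real) \<le> 2 ^ k" using power_increasing[OF that, of "2::real"] by simp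
      moreover have "1 \<le> real k" using that by simp
      ultimately show ?thesis by linarith
    qed
    show ?case
    proof (cases "k = 0")
      case True
      then show ?thesis using E1 by (simp add: D_def harm_expand)
    next
      case False
      have "D 1 k = (real k - 3) / (4 * 2 ^ k)"
        using False E1 by (simp add: D_def harm_expand field_simps)
      then have "\<bar>D 1 k\<bar> = \<bar>real k - 3\<bar> / (4 * 2 ^ k)" by (simp add: abs_divide abs_mult)
      also have "\<dots> \<le> 1 / 4" using pow False by (simp add: field_simps)
      finally show ?thesis by simp
    qed
  next
    case (step m)
    have "real (Suc m) * \<bar>D (Suc m) k\<bar> = \<bar>(real m - 1) * D m k + (if k = 0 then 0 else D m (k - 1))\<bar>"
      using DS[OF step.hyps(1), of k] by (metis abs_mult abs_of_nat)
    also have "\<dots> \<le> (real m - 1) * (1 / (4 * real m)) + 1 / (4 * real m)"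
    proof (intro abs_triangle_ineq[THEN order_trans] add_mono)
      have "0 \<le> real m - 1" using step.hyps(1) by simp
      from mult_left_mono[OF step.IH[of k] this] this
      show "\<bar>(real m - 1) * D m k\<bar> \<le> (real m - 1) * (1 / (4 * real m))"
        by (simp only: abs_mult abs_of_nonneg)
    qed (use step.IH[of "k - 1"] in auto)
    also have "\<dots> = 1 / 4"
      using step.hyps(1) by (simp add: field_simps)
    finally show ?case by (simp add: field_simps)
  qed
  from this[OF n] show ?thesis by (simp add: D_def)
qed

section \<open>Minima and their victims in a sequence\<close>

text \<open>
  For a sequence of ordinates listed by increasing abscissa, the points below the \<open>m\<close>th one
  are the earlier entries with a smaller value.
\<close>

definition earlier_below :: "(nat \<Rightarrow> real) \<Rightarrow> nat \<Rightarrow> nat set" where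
  "earlier_below y m = {i \<in> {1..<m}. y i < y m}"

text \<open>
  The points with the \<open>m\<close>th one as the only point below them. For a minimal point \<open>m\<close> these are
  the records that \<open>m\<close> breaks when it is added last.
\<close>

definition victims :: "(nat \<Rightarrow> real) \<Rightarrow> nat \<Rightarrow> nat \<Rightarrow> nat set" where
  "victims y n m = {j \<in> {1..n}. earlier_below y j = {m}}"

text \<open>
  A tie goes to the latest index, in accordance with the strict order in \<open>earlier_below\<close>, so
  that the recursions for the victims hold pointwise for every sequence, ties included. The
  value at \<open>0\<close> is a dummy.
\<close>

fun argmin_upto :: "(nat \<Rightarrow> real) \<Rightarrow> nat \<Rightarrow> nat" where
  "argmin_upto y 0 = 0"
| "argmin_upto y (Suc n) = (if earlier_below y (Suc n) = {} then Suc n else argmin_upto y n)"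

definition min_kills :: "(nat \<Rightarrow> real) \<Rightarrow> nat \<Rightarrow> nat" where
  "min_kills y n = card (victims y n (argmin_upto y n))"

definition num_killing :: "(nat \<Rightarrow> real) \<Rightarrow> nat \<Rightarrow> nat \<Rightarrow> nat" where
  "num_killing y n k = card {m \<in> {1..n}. earlier_below y m = {} \<and> card (victims y n m) = k}"

lemma finite_earlier_below [simp]: "finite (earlier_below y m)"
  by (simp add: earlier_below_def)

lemma earlier_below_subset: "earlier_below y m \<subseteq> {1..<m}"
  by (auto simp: earlier_below_def)

lemma finite_victims [simp]: "finite (victims y n m)"
  by (simp add: victims_def)

lemma argmin_upto:
  assumes "n \<ge> 1"
  shows "argmin_upto y n \<in> {1..n}" "i \<in> {1..n} \<Longrightarrow> y (argmin_upto y n) \<le> y i"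
proof -
  have "argmin_upto y n \<in> {1..n} \<and> (\<forall>i\<in>{1..n}. y (argmin_upto y n) \<le> y i)"
    using assms
  proof (induction n rule: dec_induct)
    case base
    show ?case by (simp add: earlier_below_def)
  next
    case (step n)
    show ?case
    proof (cases "earlier_below y (Suc n) = {}")
      case True
      then show ?thesis by (auto simp: earlier_below_def not_less le_Suc_eq)
    next
      case False
      then obtain i where "i \<in> {1..n}" and "y i < y (Suc n)"
        by (force simp: earlier_below_def)
      with step.IH have "y (argmin_upto y n) < y (Suc n)" by (meson order_le_less_trans)
      moreover have "{1..Suc n} = insert (Suc n) {1..n}" by (simp add: atLeastAtMostSuc_conv)
      ultimately show ?thesis using False step.IH by simp
    qed
  qed
  then show "argmin_upto y n \<in> {1..n}" "i \<in> {1..n} \<Longrightarrow> y (argmin_upto y n) \<le> y i"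
    by auto
qed

lemma eq_singleton_iff_card: "a \<in> S \<Longrightarrow> S = {m} \<longleftrightarrow> card S = 1 \<and> m = a"
  by (auto simp: card_1_singleton_iff)

text \<open>
  Whatever lies below the new entry has the current minimum below it too, so a single entry
  below the new one can only be that minimum.
\<close>

lemma earlier_below_singleton_iff:
  assumes "n \<ge> 1"
  shows "earlier_below y (Suc n) = {m} \<longleftrightarrow>
         card (earlier_below y (Suc n)) = 1 \<and> m = argmin_upto y n"
proof (cases "earlier_below y (Suc n) = {}")
  case False
  then obtain i where "i \<in> {1..n}" "y i < y (Suc n)"
    by (force simp: earlier_below_def)
  then have "argmin_upto y n \<in> earlier_below y (Suc n)"
    using argmin_upto(1)[OF assms, of y] argmin_upto(2)[OF assms, of i y]
    by (simp add: earlier_below_def)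
  then show ?thesis by (rule eq_singleton_iff_card)
qed simp

lemma victims_Suc:
  assumes "n \<ge> 1"
  shows "victims y (Suc n) m =
    (if card (earlier_below y (Suc n)) = 1 \<and> m = argmin_upto y n
     then insert (Suc n) (victims y n m) else victims y n m)"
proof -
  have "{j \<in> insert a A. P j} = (if P a then insert a {j \<in> A. P j} else {j \<in> A. P j})"
    for a :: nat and A P by auto
  moreover have "{1..Suc n} = insert (Suc n) {1..n}" by (simp add: atLeastAtMostSuc_conv)
  ultimately show ?thesis
    unfolding victims_def by (simp only: earlier_below_singleton_iff[OF assms])
qed

lemma earlier_below_argmin:
  assumes "n \<ge> 1"
  shows "earlier_below y (argmin_upto y n) = {}"
  using argmin_upto[OF assms, where y=y] by (fastforce simp: earlier_below_def)

lemma victims_outside: "n < m \<Longrightarrow> victims y n m = {}"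
  using earlier_below_subset[of y] by (fastforce simp: victims_def)

lemma card_victims_Suc:
  assumes "n \<ge> 1"
  shows "card (victims y (Suc n) m) = card (victims y n m)
     + of_bool (card (earlier_below y (Suc n)) = 1 \<and> m = argmin_upto y n)"
proof -
  have "Suc n \<notin> victims y n m" for m by (simp add: victims_def)
  then show ?thesis unfolding victims_Suc[OF assms] by simp
qed

text \<open>
  The number of victims of the current minimum is a Markov chain driven by the rank of the
  new entry: reset at rank 0, step up at rank 1, and no move otherwise.
\<close>

lemma min_kills_Suc:
  assumes "n \<ge> 1"
  shows "min_kills y (Suc n) =
    (if card (earlier_below y (Suc n)) = 0 then 0
     else min_kills y n + of_bool (card (earlier_below y (Suc n)) = 1))"
  using argmin_upto(1)[OF assms, of y]
  by (simp add: min_kills_def card_victims_Suc[OF assms] victims_outside del: One_nat_def)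

lemma min_kills_1 [simp]: "min_kills y (Suc 0) = 0"
proof -
  have [simp]: "earlier_below y (Suc 0) = {}" by (auto simp: earlier_below_def)
  have "victims y (Suc 0) (Suc 0) = {}" by (auto simp: victims_def)
  then show ?thesis by (simp add: min_kills_def)
qed

lemma num_killing_1 [simp]: "num_killing y (Suc 0) k = of_bool (k = 0)"
proof -
  have [simp]: "earlier_below y (Suc 0) = {}" by (auto simp: earlier_below_def)
  have [simp]: "victims y (Suc 0) (Suc 0) = {}" by (auto simp: victims_def)
  have "{m \<in> {Suc 0}. earlier_below y m = {} \<and> card (victims y (Suc 0) m) = k} =
        (if k = 0 then {Suc 0} else {})"
    by auto
  then show ?thesis by (simp add: num_killing_def)
qed

lemma num_killing_eq_sum:
  "real (num_killing y n k) = (\<Sum>m\<in>{1..n}. of_bool (earlier_below y m = {} \<and> card (victims y n m) = k))"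
  by (simp add: num_killing_def of_bool_def flip: sum.inter_filter)

text \<open>
  Only the current minimum can gain a victim, so the count for \<open>k\<close> changes in three ways: a new
  minimum enters with no victims, or the current minimum moves into or out of the class \<open>k\<close>.
\<close>

lemma num_killing_Suc:
  assumes n: "n \<ge> 1"
  shows "real (num_killing y (Suc n) k) = real (num_killing y n k)
    + of_bool (card (earlier_below y (Suc n)) = 0 \<and> k = 0)
    + of_bool (card (earlier_below y (Suc n)) = 1 \<and> min_kills y n + 1 = k)
    - of_bool (card (earlier_below y (Suc n)) = 1 \<and> min_kills y n = k)"
proof -
  let ?f = "\<lambda>n m. of_bool (earlier_below y m = {} \<and> card (victims y n m) = k) :: real"
  let ?a = "argmin_upto y n"
  have last: "?f (Suc n) (Suc n) = of_bool (card (earlier_below y (Suc n)) = 0 \<and> k = 0)"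
    using victims_outside[of n "Suc n" y] argmin_upto(1)[OF n, of y]
    by (auto simp: card_victims_Suc[OF n])
  have "(\<Sum>m\<in>{1..n}. ?f (Suc n) m) = (\<Sum>m\<in>{1..n}. ?f n m + (if m = ?a then
     of_bool (card (earlier_below y (Suc n)) = 1 \<and> min_kills y n + 1 = k)
    - of_bool (card (earlier_below y (Suc n)) = 1 \<and> min_kills y n = k) else 0))"
    using earlier_below_argmin[OF n, of y]
    by (intro sum.cong) (auto simp: card_victims_Suc[OF n] min_kills_def)
  also have "\<dots> = (\<Sum>m\<in>{1..n}. ?f n m)
    + of_bool (card (earlier_below y (Suc n)) = 1 \<and> min_kills y n + 1 = k)
    - of_bool (card (earlier_below y (Suc n)) = 1 \<and> min_kills y n = k)"
    using argmin_upto(1)[OF n, of y] by (simp add: sum.distrib)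
  finally show ?thesis using last by (simp add: num_killing_eq_sum)
qed

section \<open>Order patterns and permutations\<close>

text \<open>
  Equality of the order patterns of \<open>y\<close> and \<open>z\<close> on \<open>I\<close>. A property that respects this relation
  depends on the relative order of the entries in \<open>I\<close> only.
\<close>

definition order_equiv :: "nat set \<Rightarrow> (nat \<Rightarrow> real) \<Rightarrow> (nat \<Rightarrow> real) \<Rightarrow> bool" where
  "order_equiv I y z \<longleftrightarrow> (\<forall>i\<in>I. \<forall>j\<in>I. y i < y j \<longleftrightarrow> z i < z j)"

lemma earlier_below_cong:
  assumes "order_equiv {1..n} y z" and "m \<le> n"
  shows "earlier_below y m = earlier_below z m"
proof -
  have "y i < y m \<longleftrightarrow> z i < z m" if "i \<in> {1..<m}" for i
  proof -
    have "i \<in> {1..n}" "m \<in> {1..n}" using that assms(2) by auto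
    then show ?thesis using assms(1) unfolding order_equiv_def by blast
  qed
  then show ?thesis unfolding earlier_below_def by blast
qed

lemma argmin_upto_cong:
  "(\<And>m. m \<le> n \<Longrightarrow> earlier_below y m = earlier_below z m) \<Longrightarrow> argmin_upto y n = argmin_upto z n"
proof (induction n)
  case (Suc n)
  have "argmin_upto y n = argmin_upto z n" by (rule Suc.IH) (rule Suc.prems, simp)
  then show ?case using Suc.prems[of "Suc n"] by (simp only: argmin_upto.simps order_refl simp_thms)
qed simp

lemma victims_cong: "order_equiv {1..n} y z \<Longrightarrow> victims y n m = victims z n m"
  unfolding victims_def by (intro Collect_cong) (metis atLeastAtMost_iff earlier_below_cong)

lemma min_kills_cong: "order_equiv {1..n} y z \<Longrightarrow> min_kills y n = min_kills z n"
  unfolding min_kills_def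
  by (metis victims_cong argmin_upto_cong earlier_below_cong)

text \<open>
  The ranks of the entries form a permutation; its inverse sorts.
\<close>

lemma sort_permutation:
  assumes "inj_on y {1..n}"
  obtains p where "p permutes {1..n}" "order_equiv {1..n} (y \<circ> p) real"
proof -
  define r where "r i = (if i \<in> {1..n} then card {j \<in> {1..n}. y j \<le> y i} else i)" for i
  have less: "r i < r j" if "i \<in> {1..n}" "j \<in> {1..n}" "y i < y j" for i j
  proof -
    have "{l \<in> {1..n}. y l \<le> y i} \<subset> {l \<in> {1..n}. y l \<le> y j}"
    proof (rule psubsetI)
      show "{l \<in> {1..n}. y l \<le> y i} \<subseteq> {l \<in> {1..n}. y l \<le> y j}" using that(3) by auto
      have "j \<in> {l \<in> {1..n}. y l \<le> y j} - {l \<in> {1..n}. y l \<le> y i}" using that by simp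
      then show "{l \<in> {1..n}. y l \<le> y i} \<noteq> {l \<in> {1..n}. y l \<le> y j}" by blast
    qed
    then show ?thesis using that by (simp add: r_def psubset_card_mono)
  qed
  have less_iff: "r i < r j \<longleftrightarrow> y i < y j" if "i \<in> {1..n}" "j \<in> {1..n}" for i j
    using less[OF that] less[OF that(2,1)] that inj_onD[OF assms, of i j] by force
  have "r permutes {1..n}"
  proof (rule inj_imp_permutes)
    show "inj_on r {1..n}"
      using less_iff assms by (metis inj_on_def linorder_less_linear less_irrefl)
    show "r i \<in> {1..n}" if "i \<in> {1..n}" for i
    proof -
      have "card {j \<in> {1..n}. y j \<le> y i} \<le> card {1..n}" by (intro card_mono) auto
      moreover have "card {j \<in> {1..n}. y j \<le> y i} > 0" using that by (auto simp: card_gt_0_iff)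
      ultimately show ?thesis using that by (simp add: r_def)
    qed
  qed (auto simp: r_def)
  then have p: "inv r permutes {1..n}" and "\<And>i. r (inv r i) = i"
    by (auto simp: permutes_inv permutes_inverses)
  moreover have "order_equiv {1..n} (y \<circ> inv r) real"
    unfolding order_equiv_def using calculation less_iff permutes_in_image[OF p]
    by (metis comp_apply of_nat_less_iff)
  ultimately show ?thesis using that by blast
qed

lemma order_equiv_comp:
  "order_equiv I y z \<Longrightarrow> p permutes I \<Longrightarrow> order_equiv I (y \<circ> p) (z \<circ> p)"
  by (auto simp: order_equiv_def permutes_in_image)

text \<open>
  The arrangements of \<open>n\<close> distinct values show every order pattern exactly once, so the number of
  arrangements with a given order property is the same for all choices of the values. The
  bijection composes with a permutation that sorts \<open>y\<close>.
\<close>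

lemma card_permutations_order_invariant:
  assumes inv: "\<And>y z. order_equiv {1..n} y z \<Longrightarrow> A y \<longleftrightarrow> A z" and inj: "inj_on y {1..n}"
  shows "card {p. p permutes {1..n} \<and> A (y \<circ> p)} = card {p. p permutes {1..n} \<and> A (real \<circ> p)}"
proof -
  obtain r where r: "r permutes {1..n}" and ord: "order_equiv {1..n} (y \<circ> r) real"
    using sort_permutation[OF inj] .
  have A: "A (y \<circ> (r \<circ> p)) \<longleftrightarrow> A (real \<circ> p)" if "p permutes {1..n}" for p
    using inv[OF order_equiv_comp[OF ord that]] by (simp add: comp_assoc)
  have "bij_betw ((\<circ>) r) {p. p permutes {1..n} \<and> A (real \<circ> p)} {p. p permutes {1..n} \<and> A (y \<circ> p)}"
  proof (rule bij_betw_byWitness[where f' = "(\<circ>) (inv r)"], goal_cases)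
    case 1
    show ?case using permutes_inv_o[OF r] by (auto simp flip: comp_assoc)
  next
    case 2
    show ?case using permutes_inv_o[OF r] by (auto simp flip: comp_assoc)
  next
    case 3
    show ?case using A r by (auto intro: permutes_compose)
  next
    case 4
    show ?case
    proof safe
      fix p assume p: "p permutes {1..n}" "A (y \<circ> p)"
      show *: "inv r \<circ> p permutes {1..n}" using p r by (auto intro: permutes_compose permutes_inv)
      show "A (real \<circ> (inv r \<circ> p))"
        using A[OF *] p permutes_inv_o[OF r] by (simp flip: comp_assoc)
    qed
  qed
  then show ?thesis by (simp add: bij_betw_same_card)
qed

lemma card_less_rank:
  assumes "inj_on y {1..Suc n}" "r \<le> n"
  shows "card {m \<in> {1..Suc n}. card {i \<in> {1..Suc n}. y i < (y m :: real)} = r} = 1"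
proof -
  define rk where "rk m = card {i \<in> {1..Suc n}. y i < y m}" for m
  have less: "rk i < rk j" if "i \<in> {1..Suc n}" "j \<in> {1..Suc n}" "y i < y j" for i j
    unfolding rk_def
  proof (rule psubset_card_mono)
    have "i \<in> {l \<in> {1..Suc n}. y l < y j} - {l \<in> {1..Suc n}. y l < y i}" using that by simp
    moreover have "{l \<in> {1..Suc n}. y l < y i} \<subseteq> {l \<in> {1..Suc n}. y l < y j}" using that(3) by auto
    ultimately show "{l \<in> {1..Suc n}. y l < y i} \<subset> {l \<in> {1..Suc n}. y l < y j}" by blast
  qed simp
  have inj: "inj_on rk {1..Suc n}"
  proof (rule inj_onI)
    fix i j assume ij: "i \<in> {1..Suc n}" "j \<in> {1..Suc n}" "rk i = rk j"
    then have "y i = y j" using less[of i j] less[of j i] by (metis less_irrefl linorder_less_linear)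
    then show "i = j" using inj_onD[OF assms(1)] ij by blast
  qed
  have "rk ` {1..Suc n} \<subseteq> {..n}"
  proof safe
    fix m assume m: "m \<in> {1..Suc n}"
    have "{i \<in> {1..Suc n}. y i < y m} \<subseteq> {1..Suc n} - {m}" by auto
    then have "rk m \<le> card ({1..Suc n} - {m})" unfolding rk_def by (intro card_mono) auto
    then show "rk m \<le> n" using m by simp
  qed
  then have "rk ` {1..Suc n} = {..n}"
    using card_image[OF inj] by (intro card_subset_eq) auto
  then obtain m where m: "m \<in> {1..Suc n}" "rk m = r" using assms(2) by (metis atMost_iff imageE)
  then have "{m \<in> {1..Suc n}. rk m = r} = {m}" using inj_onD[OF inj] by blast
  then show ?thesis by (simp add: rk_def)
qed

section \<open>Records among finitely many points of the plane\<close>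

definition dominators :: "(nat \<Rightarrow> real) \<Rightarrow> (nat \<Rightarrow> real) \<Rightarrow> nat \<Rightarrow> nat \<Rightarrow> nat set" where
  "dominators x y n j = {i \<in> {1..n}. x i < x j \<and> y i < y j}"

text \<open>
  The first conjunct says that point \<open>m\<close> is minimal among the first \<open>n\<close>. The condition is
  symmetric in the points, which makes exchangeability applicable; for \<open>m = n\<close> it is the event
  in question.
\<close>

definition kills_exactly :: "(nat \<Rightarrow> real) \<Rightarrow> (nat \<Rightarrow> real) \<Rightarrow> nat \<Rightarrow> nat \<Rightarrow> nat \<Rightarrow> bool" where
  "kills_exactly x y n k m \<longleftrightarrow>
     dominators x y n m = {} \<and> card {j \<in> {1..n}. dominators x y n j = {m}} = k"

text \<open>
  A record at time \<open>n - 1\<close> loses its status at time \<open>n\<close> iff point \<open>n\<close> is the only point below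
  it.
\<close>

lemma K_eq_iff:
  assumes "n \<ge> 1"
  shows "K X n = int k \<longleftrightarrow> kills_exactly (\<lambda>i. fst (X i)) (\<lambda>i. snd (X i)) n k n"
proof -
  let ?d = "dominators (\<lambda>i. fst (X i)) (\<lambda>i. snd (X i)) n"
  have split: "{1..n} = insert n {1..<n}" "{1..n - 1} = {1..<n}" using assms by auto
  have mem: "i \<in> ?d j \<longleftrightarrow> i \<in> {1..n} \<and> X j \<succ> X i" for i j
    by (auto simp: dominators_def prec_def)
  have irr: "\<not> prec z z" for z by (simp add: prec_def)
  have "sets_record X n \<longleftrightarrow> ?d n = {}"
    unfolding sets_record_def set_eq_iff mem split(1) using irr by blast
  moreover have "broken_records X n = {j \<in> {1..n}. ?d j = {n}}"
  proof (rule set_eqI)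
    fix j
    have "j \<in> broken_records X n \<longleftrightarrow>
        j \<in> {1..<n} \<and> (\<forall>i\<in>{1..<n}. \<not> prec (X i) (X j)) \<and> prec (X n) (X j)"
      unfolding broken_records_def current_record_def split by auto
    also have "\<dots> \<longleftrightarrow> j \<in> {1..n} \<and> (\<forall>i\<in>{1..<n}. \<not> prec (X i) (X j)) \<and> prec (X n) (X j)"
      unfolding split(1) using irr by blast
    also have "\<dots> \<longleftrightarrow> j \<in> {j \<in> {1..n}. ?d j = {n}}"
      unfolding mem_Collect_eq set_eq_iff mem split(1) singleton_iff by (metis insert_iff atLeastLessThan_iff less_irrefl)
    finally show "j \<in> broken_records X n \<longleftrightarrow> j \<in> {j \<in> {1..n}. ?d j = {n}}" .
  qed
  ultimately show ?thesis by (simp add: K_def kills_exactly_def)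
qed

lemma dominators_cong:
  assumes "order_equiv {1..n} x x'" "order_equiv {1..n} y y'" "j \<in> {1..n}"
  shows "dominators x y n j = dominators x' y' n j"
  using assms unfolding dominators_def order_equiv_def by blast

lemma kills_exactly_cong:
  assumes "order_equiv {1..n} x x'" "order_equiv {1..n} y y'" "m \<in> {1..n}"
  shows "kills_exactly x y n k m \<longleftrightarrow> kills_exactly x' y' n k m"
proof -
  have "{j \<in> {1..n}. dominators x y n j = {m}} = {j \<in> {1..n}. dominators x' y' n j = {m}}"
    using dominators_cong[OF assms(1,2)] by (intro Collect_cong) (simp cong: conj_cong)
  then show ?thesis using dominators_cong[OF assms] by (simp add: kills_exactly_def)
qed

lemma dominators_permute:
  assumes "p permutes {1..n}"
  shows "dominators x y n (p j) = p ` dominators (x \<circ> p) (y \<circ> p) n j"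
proof -
  have "p ` {i \<in> {1..n}. (x \<circ> p) i < (x \<circ> p) j \<and> (y \<circ> p) i < (y \<circ> p) j}
     = {i \<in> p ` {1..n}. x i < x (p j) \<and> y i < y (p j)}" by force
  then show ?thesis by (simp only: permutes_image[OF assms] dominators_def)
qed

lemma kills_exactly_permute:
  assumes p: "p permutes {1..n}"
  shows "kills_exactly x y n k (p m) \<longleftrightarrow> kills_exactly (x \<circ> p) (y \<circ> p) n k m"
proof -
  have eq: "dominators x y n (p j) = {p m} \<longleftrightarrow> dominators (x \<circ> p) (y \<circ> p) n j = {m}" for j
    unfolding dominators_permute[OF p]
    using inj_image_eq_iff[OF permutes_inj[OF p], of _ "{m}"] by simp
  have "p ` {j \<in> {1..n}. dominators x y n (p j) = {p m}} = {j \<in> p ` {1..n}. dominators x y n j = {p m}}"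
    by blast
  then have "{j \<in> {1..n}. dominators x y n j = {p m}} =
      p ` {j \<in> {1..n}. dominators (x \<circ> p) (y \<circ> p) n j = {m}}"
    by (simp only: permutes_image[OF p] eq)
  then have "card {j \<in> {1..n}. dominators x y n j = {p m}} =
      card {j \<in> {1..n}. dominators (x \<circ> p) (y \<circ> p) n j = {m}}"
    by (simp only: card_image[OF permutes_inj_on[OF p]])
  then show ?thesis by (simp add: kills_exactly_def dominators_permute[OF p])
qed

lemma kills_exactly_sorted:
  assumes "m \<in> {1..n}"
  shows "kills_exactly real y n k m \<longleftrightarrow> earlier_below y m = {} \<and> card (victims y n m) = k"
proof -
  have dom: "dominators real y n j = earlier_below y j" if "j \<in> {1..n}" for j
    using that unfolding dominators_def earlier_below_def by (intro Collect_cong) auto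
  have "{j \<in> {1..n}. dominators real y n j = {m}} = victims y n m"
    unfolding victims_def using dom by (intro Collect_cong) (simp cong: conj_cong)
  then show ?thesis using dom[OF assms] by (simp add: kills_exactly_def)
qed

lemma card_kills_exactly:
  assumes p: "p permutes {1..n}" and sorted: "order_equiv {1..n} (x \<circ> p) real"
  shows "card {m \<in> {1..n}. kills_exactly x y n k m} = num_killing (y \<circ> p) n k"
proof -
  have "p ` {m \<in> {1..n}. kills_exactly x y n k (p m)} = {m \<in> p ` {1..n}. kills_exactly x y n k m}"
    by blast
  then have "card {m \<in> {1..n}. kills_exactly x y n k m} = card (p ` {m \<in> {1..n}. kills_exactly x y n k (p m)})"
    by (simp only: permutes_image[OF p])
  also have "\<dots> = card {m \<in> {1..n}. kills_exactly x y n k (p m)}"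
    by (simp only: card_image[OF permutes_inj_on[OF p]])
  also have "{m \<in> {1..n}. kills_exactly x y n k (p m)} =
     {m \<in> {1..n}. earlier_below (y \<circ> p) m = {} \<and> card (victims (y \<circ> p) n m) = k}"
  proof (intro Collect_cong conj_cong refl)
    fix m assume m: "m \<in> {1..n}"
    have "order_equiv {1..n} (y \<circ> p) (y \<circ> p)" by (simp add: order_equiv_def)
    then show "kills_exactly x y n k (p m) \<longleftrightarrow> earlier_below (y \<circ> p) m = {} \<and> card (victims (y \<circ> p) n m) = k"
      unfolding kills_exactly_permute[OF p] using kills_exactly_cong[OF sorted _ m] kills_exactly_sorted[OF m] by blast
  qed
  finally show ?thesis by (simp only: num_killing_def)
qed

section \<open>Independent samples from an atomless law\<close>

text \<open>
  The space splits into finitely many pieces, one for each truth assignment to the tests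
  \<open>F d\<close>, and \<open>A\<close> is a union of pieces. This gives measurability of every event that is a
  function of finitely many comparisons.
\<close>

lemma pred_finitely_determined:
  fixes F :: "'d \<Rightarrow> 'w \<Rightarrow> bool"
  assumes D: "finite D" and F: "\<And>d. d \<in> D \<Longrightarrow> Measurable.pred N (F d)"
    and A: "\<And>w w'. (\<And>d. d \<in> D \<Longrightarrow> F d w \<longleftrightarrow> F d w') \<Longrightarrow> A w \<longleftrightarrow> A w'"
  shows "Measurable.pred N A"
proof -
  define \<T> where "\<T> = {T \<in> Pow D. \<exists>w'. A w' \<and> T = {d \<in> D. F d w'}}"
  have "finite \<T>" using D by (simp add: \<T>_def)
  have "A w \<longleftrightarrow> (\<exists>T\<in>\<T>. \<forall>d\<in>D. F d w \<longleftrightarrow> d \<in> T)" for w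
  proof
    assume "A w"
    then have "{d \<in> D. F d w} \<in> \<T>" unfolding \<T>_def by blast
    then show "\<exists>T\<in>\<T>. \<forall>d\<in>D. F d w \<longleftrightarrow> d \<in> T" by (rule bexI[rotated]) simp
  next
    assume "\<exists>T\<in>\<T>. \<forall>d\<in>D. F d w \<longleftrightarrow> d \<in> T"
    then obtain w' where w': "A w'" "\<And>d. d \<in> D \<Longrightarrow> F d w' \<longleftrightarrow> F d w" unfolding \<T>_def by auto
    from A[of w' w, OF w'(2)] w'(1) show "A w" by simp
  qed
  moreover have "Measurable.pred N (\<lambda>w. \<exists>T\<in>\<T>. \<forall>d\<in>D. F d w \<longleftrightarrow> d \<in> T)"
    using F D \<open>finite \<T>\<close> by (intro pred_intros_finite pred_intros_logic) auto
  ultimately show ?thesis by (simp cong: measurable_cong)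
qed

lemma sum_indicator_eq_card:
  assumes "finite I"
  shows "(\<Sum>m\<in>I. indicator {w. P m w} w) = real (card {m \<in> I. P m w})"
proof -
  have "(\<Sum>m\<in>I. indicator {w. P m w} w) = (\<Sum>m\<in>I. if P m w then 1 else (0::real))"
    by (intro sum.cong) (auto simp: indicator_def)
  then show ?thesis using assms by (simp flip: sum.inter_filter)
qed

text \<open>
  Only the relative order of coordinates matters below, and for this the sole relevant property
  of the uniform law is that ties have probability zero.
\<close>

locale atomless_distribution = real_distribution U for U :: "real measure" +
  assumes atomless: "\<And>x. measure U {x} = 0"
begin

definition iid :: "(nat \<Rightarrow> real) measure" where
  "iid = (\<Pi>\<^sub>M i\<in>UNIV. U)"

sublocale S: prob_space iid
  unfolding iid_def by (intro prob_space_PiM prob_space_axioms)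

lemma space_iid [simp]: "space iid = UNIV"
  by (simp add: iid_def space_PiM)

lemma measurable_component [measurable]: "(\<lambda>y. y i) \<in> borel_measurable iid"
  unfolding iid_def by (rule measurable_compose[OF measurable_component_singleton]) (auto simp: measurable_def)

text \<open>
  Two coordinates are independent, so Fubini reduces a tie to a single atom.
\<close>

lemma AE_neq:
  assumes "i \<noteq> j"
  shows "AE y in iid. y i \<noteq> y j"
proof -
  interpret UU: pair_prob_space U U ..
  have distr_comp: "distr iid U (\<lambda>y. y l) = U" for l
    unfolding iid_def by (rule distr_PiM_component) (auto intro: prob_space_axioms)
  have rv: "S.random_variable U (\<lambda>y. y l)" for l
    by (simp add: measurable_cong_sets[OF refl events_eq_borel])
  have case_bool_U: "case_bool U U = (\<lambda>_. U)" by (auto split: bool.split)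
  have "S.indep_vars (\<lambda>_. U) (\<lambda>b y. y (case_bool i j b)) UNIV"
    using distr_PiM_reindex[of UNIV "\<lambda>_. U" "case_bool i j" UNIV] prob_space_axioms assms
    by (subst S.indep_vars_iff_distr_eq_PiM)
       (auto simp: distr_comp rv inj_def split: bool.splits simp flip: iid_def)
  moreover have "(\<lambda>b y. y (case_bool i j b)) = case_bool (\<lambda>y. y i) (\<lambda>y. y j :: real)"
    by (auto split: bool.split)
  ultimately have "S.indep_var U (\<lambda>y. y i) U (\<lambda>y. y j)"
    by (simp add: S.indep_var_def case_bool_U)
  then have eq: "U \<Otimes>\<^sub>M U = distr iid (U \<Otimes>\<^sub>M U) (\<lambda>y. (y i, y j))"
    by (simp add: S.indep_var_distribution_eq distr_comp)
  have meas: "Measurable.pred (U \<Otimes>\<^sub>M U) (\<lambda>z. fst z \<noteq> snd z)"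
    by measurable
  have "AE y in U. x \<noteq> y" for x
    using atomless[of x] by (subst AE_iff_measurable[of "{x}"]) (auto simp: emeasure_eq_measure)
  then have "AE z in U \<Otimes>\<^sub>M U. fst z \<noteq> snd z"
    using meas unfolding pred_def by (intro UU.AE_pair_measure) simp_all
  then have "AE z in distr iid (U \<Otimes>\<^sub>M U) (\<lambda>y. (y i, y j)). fst z \<noteq> snd z"
    by (rule subst[OF eq, where P = "\<lambda>M. AE z in M. fst z \<noteq> snd z"])
  then show ?thesis
    using meas rv unfolding pred_def by (subst (asm) AE_distr_iff) (auto intro: measurable_Pair)
qed

lemma AE_inj_on: "AE y in iid. inj_on y (I :: nat set)"
proof -
  have "AE y in iid. \<forall>i j. i \<noteq> j \<longrightarrow> y i \<noteq> y j"
    unfolding AE_all_countable using AE_neq by auto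
  then show ?thesis by eventually_elim (auto simp: inj_on_def)
qed

lemma pred_sets: "Measurable.pred iid Q \<Longrightarrow> {y. Q y} \<in> sets iid"
  by (simp add: pred_def)

lemma measurable_permute:
  "(\<lambda>y. y \<circ> p) \<in> measurable iid iid"
  unfolding iid_def comp_def by (rule measurable_PiM_single') (auto simp: measurable_component_singleton)

lemma distr_permute:
  assumes "p permutes I"
  shows "distr iid iid (\<lambda>y. y \<circ> p) = iid"
  using distr_PiM_reindex[of UNIV "\<lambda>_. U" p UNIV] permutes_inj[OF assms] prob_space_axioms
  by (simp add: iid_def comp_def restrict_UNIV)

lemma prob_permute:
  assumes "p permutes I" "Measurable.pred iid A"
  shows "S.prob {y. A (y \<circ> p)} = S.prob {y. A y}"
proof -
  have "S.prob {y. A y} = measure (distr iid iid (\<lambda>y. y \<circ> p)) {y. A y}"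
    by (simp add: distr_permute[OF assms(1)])
  also have "\<dots> = S.prob {y. A (y \<circ> p)}"
    using assms(2) measurable_permute by (subst measure_distr) (auto simp: pred_def vimage_def)
  finally show ?thesis by simp
qed

lemma pred_order_invariant:
  assumes "\<And>y z. order_equiv {1..n} y z \<Longrightarrow> A y \<longleftrightarrow> A z"
  shows "Measurable.pred iid A"
proof (rule pred_finitely_determined[of "{1..n} \<times> {1..n}" "\<lambda>d y. y (fst d) < y (snd d)"])
  fix y z :: "nat \<Rightarrow> real"
  assume "\<And>d. d \<in> {1..n} \<times> {1..n} \<Longrightarrow> y (fst d) < y (snd d) \<longleftrightarrow> z (fst d) < z (snd d)"
  then have "order_equiv {1..n} y z" unfolding order_equiv_def by (metis SigmaI fst_conv snd_conv)
  then show "A y \<longleftrightarrow> A z" by (rule assms)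
qed auto

text \<open>
  The relative order of the first \<open>n\<close> entries is independent of every event that permuting these
  entries does not affect. Averaging the probability of \<open>A \<and> B\<close> over all permutations
  replaces \<open>A\<close> by the proportion of arrangements of the observed values that satisfy it, which
  is almost surely a constant.
\<close>

lemma order_pattern_indep_symmetric:
  assumes A: "\<And>y z. order_equiv {1..n} y z \<Longrightarrow> A y \<longleftrightarrow> A z"
    and B: "Measurable.pred iid B" "\<And>p y. p permutes {1..n} \<Longrightarrow> B (y \<circ> p) \<longleftrightarrow> B y"
  shows "S.prob {y. A y \<and> B y} = S.prob {y. A y} * S.prob {y. B y}"
proof -
  note [measurable] = pred_order_invariant[OF A] B(1)
  define P where "P = {p. p permutes {1..n}}"
  define c where "c = real (card {p. p permutes {1..n} \<and> A (real \<circ> p)})"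
  have finP: "finite P" by (simp add: P_def finite_permutations)
  have key: "fact n * S.prob {y. A y \<and> B y} = c * S.prob {y. B y}"
    if [measurable]: "Measurable.pred iid B" and B: "\<And>p y. p permutes {1..n} \<Longrightarrow> B (y \<circ> p) \<longleftrightarrow> B y" for B
  proof -
    have meas [measurable]: "Measurable.pred iid (\<lambda>y. A (y \<circ> p))" for p
      by (rule measurable_compose[OF measurable_permute]) measurable
    have "fact n * S.prob {y. A y \<and> B y} = (\<Sum>p\<in>P. S.prob {y. A y \<and> B y})"
      by (simp add: P_def card_permutations)
    also have "\<dots> = (\<Sum>p\<in>P. S.prob {y. A (y \<circ> p) \<and> B y})"
    proof (intro sum.cong refl)
      fix p assume p: "p \<in> P"
      then show "S.prob {y. A y \<and> B y} = S.prob {y. A (y \<circ> p) \<and> B y}"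
        using prob_permute[of p "{1..n}" "\<lambda>y. A y \<and> B y"] B[of p] by (simp add: P_def)
    qed
    also have "\<dots> = (\<Sum>p\<in>P. S.expectation (indicator {y. A (y \<circ> p) \<and> B y}))"
      by simp
    also have "\<dots> = S.expectation (\<lambda>y. \<Sum>p\<in>P. indicator {y. A (y \<circ> p) \<and> B y} y)"
      by (intro Bochner_Integration.integral_sum[symmetric] integrable_real_indicator)
         (auto simp: S.emeasure_eq_measure intro!: pred_sets)
    also have "\<dots> = S.expectation (\<lambda>y. c * indicator {y. B y} y)"
    proof (intro integral_cong_AE)
      show "AE y in iid. (\<Sum>p\<in>P. indicator {y. A (y \<circ> p) \<and> B y} y) = c * indicator {y. B y} y"
        using AE_inj_on[of "{1..n}"]
      proof eventually_elim
        case (elim y)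
        have "(\<Sum>p\<in>P. indicator {y. A (y \<circ> p) \<and> B y} y) = (\<Sum>p\<in>P. if A (y \<circ> p) then indicator {y. B y} y else (0::real))"
          by (intro sum.cong) (auto simp: indicator_def)
        also have "\<dots> = real (card {p. p permutes {1..n} \<and> A (y \<circ> p)}) * indicator {y. B y} y"
          using finP by (simp add: P_def flip: sum.inter_filter)
        also have "\<dots> = c * indicator {y. B y} y"
          using card_permutations_order_invariant[where A = A and y = y, OF A elim] by (simp add: c_def)
        finally show ?case .
      qed
    qed (auto simp: pred_def[symmetric])
    also have "\<dots> = c * S.prob {y. B y}" by simp
    finally show ?thesis .
  qed
  \<comment> \<open>The trivial event for \<open>B\<close> identifies the constant as \<open>n! P(A)\<close>.\<close>
  have "fact n * S.prob {y. A y} = c"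
    using key[of "\<lambda>_. True"] S.prob_space by simp
  then have "fact n * S.prob {y. A y \<and> B y} = fact n * (S.prob {y. A y} * S.prob {y. B y})"
    using key[OF B] by simp
  then show ?thesis by simp
qed

text \<open>
  By exchangeability every position has rank \<open>r\<close> with the same probability, and almost surely
  exactly one of the \<open>n + 1\<close> positions has it.
\<close>

lemma prob_rank:
  assumes "r \<le> n"
  shows "S.prob {y. card (earlier_below y (Suc n)) = r} = 1 / real (Suc n)"
proof -
  define V where "V m y \<longleftrightarrow> card {i \<in> {1..Suc n}. y i < (y m :: real)} = r" for m and y :: "nat \<Rightarrow> real"
  have V_last: "V (Suc n) y \<longleftrightarrow> card (earlier_below y (Suc n)) = r" for y
  proof -
    have "{i \<in> {1..Suc n}. y i < y (Suc n)} = earlier_below y (Suc n)"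
      unfolding earlier_below_def by (auto simp: less_Suc_eq_le le_less)
    then show ?thesis by (simp add: V_def)
  qed
  have V_permute: "V m (y \<circ> p) \<longleftrightarrow> V (p m) y" if p: "p permutes {1..Suc n}" for p m y
  proof -
    have "bij_betw p {i \<in> {1..Suc n}. (y \<circ> p) i < (y \<circ> p) m} {i \<in> {1..Suc n}. y i < y (p m)}"
      using p by (intro bij_betw_byWitness[of _ "inv p"])
        (auto simp: permutes_inverses permutes_in_image permutes_in_image[OF permutes_inv] simp del: atLeastAtMost_iff simp flip: One_nat_def)
    then show ?thesis unfolding V_def using bij_betw_same_card by fastforce
  qed
  have meas [measurable]: "Measurable.pred iid (V m)" if "m \<in> {1..Suc n}" for m
  proof (rule pred_order_invariant[of "Suc n"])
    fix y z :: "nat \<Rightarrow> real" assume "order_equiv {1..Suc n} y z"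
    then have "{i \<in> {1..Suc n}. y i < y m} = {i \<in> {1..Suc n}. z i < z m}"
      using that unfolding order_equiv_def by blast
    then show "V m y \<longleftrightarrow> V m z" by (simp add: V_def)
  qed
  have same: "S.prob {y. V m y} = S.prob {y. V (Suc n) y}" if m: "m \<in> {1..Suc n}" for m
  proof -
    have p: "Transposition.transpose m (Suc n) permutes {1..Suc n}" using m by (intro permutes_swap_id) auto
    show ?thesis
      using prob_permute[OF p meas[OF m]] by (simp add: V_permute[OF p])
  qed
  have "real (Suc n) * S.prob {y. V (Suc n) y} = (\<Sum>m\<in>{1..Suc n}. S.prob {y. V m y})"
  proof -
    have "(\<Sum>m\<in>{1..Suc n}. S.prob {y. V m y}) = (\<Sum>m\<in>{1..Suc n}. S.prob {y. V (Suc n) y})"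
      by (intro sum.cong refl same)
    then show ?thesis by simp
  qed
  also have "\<dots> = (\<Sum>m\<in>{1..Suc n}. S.expectation (indicator {y. V m y}))" by simp
  also have "\<dots> = S.expectation (\<lambda>y. \<Sum>m\<in>{1..Suc n}. indicator {y. V m y} y)"
    by (intro Bochner_Integration.integral_sum[symmetric] integrable_real_indicator)
       (auto simp only: S.emeasure_eq_measure ennreal_less_top infinity_ennreal_def intro!: pred_sets meas)
  also have "\<dots> = S.expectation (\<lambda>y. 1)"
  proof (intro integral_cong_AE)
    show "AE y in iid. (\<Sum>m\<in>{1..Suc n}. indicator {y. V m y} y) = (1::real)"
      using AE_inj_on[of "{1..Suc n}"]
    proof eventually_elim
      case (elim y)
      show ?case
        unfolding sum_indicator_eq_card[OF finite_atLeastAtMost]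
        using card_less_rank[OF elim assms] by (simp only: V_def of_nat_1)
    qed
    show "(\<lambda>y. \<Sum>m\<in>{1..Suc n}. indicator {y. V m y} y :: real) \<in> borel_measurable iid"
      by (intro borel_measurable_sum borel_measurable_indicator pred_sets meas)
  qed simp
  also have "\<dots> = 1" using S.prob_space by simp
  finally show ?thesis by (simp add: V_last field_simps)
qed

section \<open>The two recursions\<close>

lemma expectation_of_bool:
  assumes "Measurable.pred iid A"
  shows "S.expectation (\<lambda>y. of_bool (A y)) = S.prob {y. A y}"
    and "integrable iid (\<lambda>y. of_bool (A y) :: real)"
proof -
  have "(\<lambda>y. of_bool (A y) :: real) = indicator {y. A y}" by (auto simp: indicator_def)
  then show "S.expectation (\<lambda>y. of_bool (A y)) = S.prob {y. A y}"
    and "integrable iid (\<lambda>y. of_bool (A y) :: real)"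
    using pred_sets[OF assms] by (simp_all add: integrable_real_indicator S.emeasure_eq_measure)
qed

definition min_kills_prob :: "nat \<Rightarrow> nat \<Rightarrow> real" where
  "min_kills_prob n k = S.prob {y. min_kills y n = k}"

definition expected_num_killing :: "nat \<Rightarrow> nat \<Rightarrow> real" where
  "expected_num_killing n k = S.expectation (\<lambda>y. real (num_killing y n k))"

lemma pred_min_kills: "Measurable.pred iid (\<lambda>y. min_kills y n = k)"
  by (rule pred_order_invariant[of n]) (simp only: min_kills_cong)

lemma pred_card_earlier_below: "Measurable.pred iid (\<lambda>y. card (earlier_below y m) = r)"
proof (rule pred_order_invariant[of m])
  fix y z :: "nat \<Rightarrow> real" assume "order_equiv {1..m} y z"
  then have "earlier_below y m = earlier_below z m" by (rule earlier_below_cong) simp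
  then show "card (earlier_below y m) = r \<longleftrightarrow> card (earlier_below z m) = r" by simp
qed

lemma card_earlier_below_permute:
  assumes p: "p permutes {1..n}"
  shows "card (earlier_below (y \<circ> p) (Suc n)) = card (earlier_below y (Suc n))"
proof -
  have eq: "{1..<Suc n} = {1..n}" and "p (Suc n) = Suc n" using permutes_not_in[OF p, of "Suc n"] by auto
  then have "p ` {i \<in> {1..n}. (y \<circ> p) i < (y \<circ> p) (Suc n)} = {i \<in> p ` {1..n}. y i < y (Suc n)}" by force
  then have "p ` earlier_below (y \<circ> p) (Suc n) = earlier_below y (Suc n)"
    by (simp only: permutes_image[OF p] earlier_below_def eq)
  then show ?thesis by (metis card_image[OF permutes_inj_on[OF p]])
qed

lemma prob_rank_min_kills:
  assumes "r \<le> n"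
  shows "S.prob {y. card (earlier_below y (Suc n)) = r \<and> min_kills y n = k} =
         min_kills_prob n k / real (Suc n)"
proof -
  have "S.prob {y. min_kills y n = k \<and> card (earlier_below y (Suc n)) = r} =
     S.prob {y. min_kills y n = k} * S.prob {y. card (earlier_below y (Suc n)) = r}"
  proof (rule order_pattern_indep_symmetric[of n])
    show "card (earlier_below (y \<circ> p) (Suc n)) = r \<longleftrightarrow> card (earlier_below y (Suc n)) = r"
      if "p permutes {1..n}" for p y using card_earlier_below_permute[OF that] by simp
  qed (auto simp only: min_kills_cong pred_card_earlier_below)
  then show ?thesis by (simp add: prob_rank[OF assms] min_kills_prob_def conj_commute)
qed

lemma prob_second_min_kills:
  assumes n: "n \<ge> 1"
  shows "S.prob {y. card (earlier_below y (Suc n)) = 1 \<and> min_kills y n + 1 = k} =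
         (if k = 0 then 0 else min_kills_prob n (k - 1)) / real (Suc n)"
proof (cases k)
  case (Suc l)
  then show ?thesis using prob_rank_min_kills[OF n, of l] by simp
qed simp

lemma prob_minimum:
  "S.prob {y. card (earlier_below y (Suc n)) = 0 \<and> k = (0::nat)} = of_bool (k = 0) / real (Suc n)"
  using prob_rank[of 0 n] by (cases "k = 0") simp_all

lemma pred_rank_min_kills:
  "Measurable.pred iid (\<lambda>y. card (earlier_below y (Suc n)) = r \<and> min_kills y n = k)"
  "Measurable.pred iid (\<lambda>y. card (earlier_below y (Suc n)) = r \<and> min_kills y n + 1 = k)"
  "Measurable.pred iid (\<lambda>y. card (earlier_below y (Suc n)) = r \<and> k = (0::nat))"
proof -
  have "Measurable.pred iid (\<lambda>y. min_kills y n + 1 = k)"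
    by (rule pred_order_invariant[of n]) (simp only: min_kills_cong)
  then show "Measurable.pred iid (\<lambda>y. card (earlier_below y (Suc n)) = r \<and> min_kills y n = k)"
  "Measurable.pred iid (\<lambda>y. card (earlier_below y (Suc n)) = r \<and> min_kills y n + 1 = k)"
  "Measurable.pred iid (\<lambda>y. card (earlier_below y (Suc n)) = r \<and> k = (0::nat))"
    by (intro pred_intros_logic pred_card_earlier_below pred_min_kills; simp)+
qed

text \<open>
  Expand the event along \<open>min_kills_Suc\<close> and use that the rank of the new entry is independent
  of the number of victims so far.
\<close>

lemma min_kills_prob_Suc:
  assumes n: "n \<ge> 1"
  shows "real (Suc n) * min_kills_prob (Suc n) k =
         (real n - 1) * min_kills_prob n k + (if k = 0 then 1 else min_kills_prob n (k - 1))"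
proof -
  let ?r = "\<lambda>y. card (earlier_below y (Suc n))"
  have "of_bool (min_kills y (Suc n) = k) =
      of_bool (?r y = 0 \<and> k = 0) + of_bool (?r y = 1 \<and> min_kills y n + 1 = k)
      + of_bool (min_kills y n = k) - of_bool (?r y = 0 \<and> min_kills y n = k)
      - (of_bool (?r y = 1 \<and> min_kills y n = k) :: real)" for y
    unfolding min_kills_Suc[OF n] by auto
  then have "S.prob {y. min_kills y (Suc n) = k} =
      S.prob {y. ?r y = 0 \<and> k = 0} + S.prob {y. ?r y = 1 \<and> min_kills y n + 1 = k}
      + S.prob {y. min_kills y n = k} - S.prob {y. ?r y = 0 \<and> min_kills y n = k}
      - S.prob {y. ?r y = 1 \<and> min_kills y n = k}"
    unfolding expectation_of_bool(1)[OF pred_min_kills, symmetric]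
      expectation_of_bool(1)[OF pred_rank_min_kills(1), symmetric]
      expectation_of_bool(1)[OF pred_rank_min_kills(2), symmetric]
      expectation_of_bool(1)[OF pred_rank_min_kills(3), symmetric]
    by (simp only: Bochner_Integration.integral_add Bochner_Integration.integral_diff
        Bochner_Integration.integrable_add Bochner_Integration.integrable_diff
        expectation_of_bool(2)[OF pred_min_kills] expectation_of_bool(2)[OF pred_rank_min_kills(1)]
        expectation_of_bool(2)[OF pred_rank_min_kills(2)] expectation_of_bool(2)[OF pred_rank_min_kills(3)])
  then have "min_kills_prob (Suc n) k = (of_bool (k = 0) + (if k = 0 then 0 else min_kills_prob n (k - 1))
      - 2 * min_kills_prob n k) / real (Suc n) + min_kills_prob n k"
    unfolding prob_minimum prob_second_min_kills[OF n] prob_rank_min_kills[OF n] prob_rank_min_kills[OF le0]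
    by (simp add: min_kills_prob_def add_divide_distrib diff_divide_distrib)
  then show ?thesis by (cases "k = 0") (simp_all add: field_simps)
qed

lemma integrable_num_killing: "integrable iid (\<lambda>y. real (num_killing y n k))"
  unfolding num_killing_eq_sum
proof (intro Bochner_Integration.integrable_sum expectation_of_bool(2) pred_order_invariant[of n])
  fix m :: nat and y z :: "nat \<Rightarrow> real" assume "m \<in> {1..n}" and yz: "order_equiv {1..n} y z"
  then have "earlier_below y m = earlier_below z m" by (intro earlier_below_cong[OF yz]) simp
  then show "earlier_below y m = {} \<and> card (victims y n m) = k \<longleftrightarrow>
      earlier_below z m = {} \<and> card (victims z n m) = k"
    by (simp add: victims_cong[OF yz])
qed

lemma expected_num_killing_Suc:
  assumes n: "n \<ge> 1"
  shows "real (Suc n) * expected_num_killing (Suc n) k = real (Suc n) * expected_num_killing n k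
         + (if k = 0 then 1 else min_kills_prob n (k - 1)) - min_kills_prob n k"
proof -
  let ?r = "\<lambda>y. card (earlier_below y (Suc n))"
  have "expected_num_killing (Suc n) k = expected_num_killing n k
      + S.prob {y. ?r y = 0 \<and> k = 0} + S.prob {y. ?r y = 1 \<and> min_kills y n + 1 = k}
      - S.prob {y. ?r y = 1 \<and> min_kills y n = k}"
    unfolding expected_num_killing_def num_killing_Suc[OF n]
      expectation_of_bool(1)[OF pred_rank_min_kills(1), symmetric]
      expectation_of_bool(1)[OF pred_rank_min_kills(2), symmetric]
      expectation_of_bool(1)[OF pred_rank_min_kills(3), symmetric]
    by (simp only: Bochner_Integration.integral_add Bochner_Integration.integral_diff
        Bochner_Integration.integrable_add Bochner_Integration.integrable_diff integrable_num_killing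
        expectation_of_bool(2)[OF pred_rank_min_kills(1)]
        expectation_of_bool(2)[OF pred_rank_min_kills(2)] expectation_of_bool(2)[OF pred_rank_min_kills(3)])
  then have "expected_num_killing (Suc n) k = expected_num_killing n k +
      (of_bool (k = 0) + (if k = 0 then 0 else min_kills_prob n (k - 1)) - min_kills_prob n k) / real (Suc n)"
    unfolding prob_minimum prob_second_min_kills[OF n] prob_rank_min_kills[OF n]
    by (simp add: add_divide_distrib diff_divide_distrib)
  then show ?thesis by (cases "k = 0") (simp_all add: field_simps)
qed

lemma expected_num_killing_bound:
  assumes "n \<ge> 1"
  shows "\<bar>expected_num_killing n k - (harm n / 2 ^ (k + 1) - (real k - 1) / 2 ^ (k + 2))\<bar>
         \<le> 1 / (4 * real n)"
  using S.prob_space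
  by (intro killing_recursion_bound[where q = min_kills_prob] min_kills_prob_Suc expected_num_killing_Suc assms)
     (auto simp: min_kills_prob_def expected_num_killing_def)

section \<open>From points of the plane to sequences\<close>

sublocale P: pair_prob_space iid iid ..

lemma pred_kills_exactly:
  assumes m: "m \<in> {1..n}"
    and f: "\<And>i. i \<in> {1..n} \<Longrightarrow> (\<lambda>w. f w i) \<in> borel_measurable N"
    and g: "\<And>i. i \<in> {1..n} \<Longrightarrow> (\<lambda>w. g w i) \<in> borel_measurable N"
  shows "Measurable.pred N (\<lambda>w. kills_exactly (f w) (g w) n k m)"
proof (rule pred_finitely_determined[of "({1..n} \<times> {1..n}) \<times> (UNIV :: bool set)"
      "\<lambda>d w. if snd d then f w (fst (fst d)) < f w (snd (fst d)) else g w (fst (fst d)) < g w (snd (fst d))"])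
  fix w w'
  assume *: "(if snd d then f w (fst (fst d)) < f w (snd (fst d)) else g w (fst (fst d)) < g w (snd (fst d))) \<longleftrightarrow>
     (if snd d then f w' (fst (fst d)) < f w' (snd (fst d)) else g w' (fst (fst d)) < g w' (snd (fst d)))"
    if "d \<in> ({1..n} \<times> {1..n}) \<times> (UNIV :: bool set)" for d
  have "order_equiv {1..n} (f w) (f w')"
    using *[of "((_, _), True)"] by (simp add: order_equiv_def)
  moreover have "order_equiv {1..n} (g w) (g w')"
    using *[of "((_, _), False)"] by (simp add: order_equiv_def)
  ultimately show "kills_exactly (f w) (g w) n k m \<longleftrightarrow> kills_exactly (f w') (g w') n k m"
    using m by (rule kills_exactly_cong)
qed (use f g in \<open>auto simp del: atLeastAtMost_iff split: if_splits\<close>)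

lemma pred_kills_exactly_pair:
  assumes "m \<in> {1..n}"
  shows "Measurable.pred (iid \<Otimes>\<^sub>M iid) (\<lambda>w. kills_exactly (fst w) (snd w) n k m)"
  by (rule pred_kills_exactly[OF assms]) (auto intro: measurable_compose[OF measurable_fst] measurable_compose[OF measurable_snd])

lemma distr_permute_pair:
  assumes "p permutes I"
  shows "distr (iid \<Otimes>\<^sub>M iid) (iid \<Otimes>\<^sub>M iid) (\<lambda>(x, y). (x \<circ> p, y \<circ> p)) = iid \<Otimes>\<^sub>M iid"
  using pair_measure_distr[OF measurable_permute measurable_permute, of p p]
  by (simp add: distr_permute[OF assms] S.sigma_finite_measure_axioms)

text \<open>
  Exchangeability of the points turns the probability for point \<open>n\<close> into an expected count.
  For a fixed \<open>x\<close> without ties, reordering the points by abscissa turns the count into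
  \<open>num_killing\<close> of a permuted \<open>y\<close>, which has the same law as \<open>y\<close>.
\<close>

lemma prob_kills_exactly:
  assumes n: "n \<ge> 1"
  shows "real n * P.prob {w. kills_exactly (fst w) (snd w) n k n} = expected_num_killing n k"
proof -
  let ?B = "\<lambda>m w. kills_exactly (fst w) (snd w) n k m"
  have sets: "{w. ?B m w} \<in> sets (iid \<Otimes>\<^sub>M iid)" if "m \<in> {1..n}" for m
    using pred_kills_exactly_pair[OF that, of k] by (simp add: pred_def space_pair_measure)
  have same: "P.prob {w. ?B m w} = P.prob {w. ?B n w}" if m: "m \<in> {1..n}" for m
  proof -
    define p where "p = Transposition.transpose m n"
    have p: "p permutes {1..n}" using m n unfolding p_def by (intro permutes_swap_id) auto
    have nn: "n \<in> {1..n}" using n by simp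
    have meas: "(\<lambda>(x, y). (x \<circ> p, y \<circ> p)) \<in> measurable (iid \<Otimes>\<^sub>M iid) (iid \<Otimes>\<^sub>M iid)"
      unfolding case_prod_beta
      by (intro measurable_Pair measurable_compose[OF measurable_fst] measurable_compose[OF measurable_snd] measurable_permute)
    have "P.prob {w. ?B n w} =
        measure (distr (iid \<Otimes>\<^sub>M iid) (iid \<Otimes>\<^sub>M iid) (\<lambda>(x, y). (x \<circ> p, y \<circ> p))) {w. ?B n w}"
      by (simp only: distr_permute_pair[OF p])
    also have "\<dots> = P.prob {w. ?B n (case w of (x, y) \<Rightarrow> (x \<circ> p, y \<circ> p))}"
      using meas sets[OF nn] by (simp add: measure_distr space_pair_measure vimage_def)
    also have "{w. ?B n (case w of (x, y) \<Rightarrow> (x \<circ> p, y \<circ> p))} = {w. ?B (p n) w}"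
      by (simp add: kills_exactly_permute[OF p] case_prod_beta)
    finally show ?thesis by (simp add: p_def)
  qed
  have card_eq: "(\<Sum>m\<in>{1..n}. indicator {w. ?B m w} w) = real (card {m \<in> {1..n}. ?B m w})" for w
    by (rule sum_indicator_eq_card) simp
  have int: "integrable (iid \<Otimes>\<^sub>M iid) (indicator {w. ?B m w} :: _ \<Rightarrow> real)" if "m \<in> {1..n}" for m
    using sets[OF that] by (simp add: integrable_real_indicator P.emeasure_eq_measure)
  have int_card: "integrable (iid \<Otimes>\<^sub>M iid) (\<lambda>w. real (card {m \<in> {1..n}. ?B m w}))"
    unfolding card_eq[symmetric] by (intro Bochner_Integration.integrable_sum int)
  have "real n * P.prob {w. ?B n w} = (\<Sum>m\<in>{1..n}. P.prob {w. ?B n w})" by simp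
  also have "\<dots> = (\<Sum>m\<in>{1..n}. P.prob {w. ?B m w})"
    by (intro sum.cong refl same[symmetric])
  also have "\<dots> = (\<Sum>m\<in>{1..n}. P.expectation (indicator {w. ?B m w}))" by (simp add: space_pair_measure)
  also have "\<dots> = P.expectation (\<lambda>w. \<Sum>m\<in>{1..n}. indicator {w. ?B m w} w)"
    by (intro Bochner_Integration.integral_sum[symmetric] int)
  also have "\<dots> = P.expectation (\<lambda>w. real (card {m \<in> {1..n}. ?B m w}))"
    by (simp only: card_eq)
  also have "\<dots> = (\<integral>x. \<integral>y. real (card {m \<in> {1..n}. kills_exactly x y n k m}) \<partial>iid \<partial>iid)"
    using P.integral_fst'[OF int_card] by simp
  also have "\<dots> = (\<integral>x. expected_num_killing n k \<partial>iid)"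
  proof (intro integral_cong_AE)
    show "AE x in iid. (\<integral>y. real (card {m \<in> {1..n}. kills_exactly x y n k m}) \<partial>iid) = expected_num_killing n k"
      using AE_inj_on[of "{1..n}"]
    proof eventually_elim
      case (elim x)
      then obtain p where p: "p permutes {1..n}" "order_equiv {1..n} (x \<circ> p) real"
        by (rule sort_permutation)
      have "expected_num_killing n k = (\<integral>y. real (num_killing y n k) \<partial>distr iid iid (\<lambda>y. y \<circ> p))"
        by (simp only: expected_num_killing_def distr_permute[OF p(1)])
      also have "\<dots> = (\<integral>y. real (num_killing (y \<circ> p) n k) \<partial>iid)"
        by (intro integral_distr measurable_permute borel_measurable_integrable integrable_num_killing)
      finally show ?case by (simp only: card_kills_exactly[OF p])
    qed
    show "(\<lambda>x. \<integral>y. real (card {m \<in> {1..n}. kills_exactly x y n k m}) \<partial>iid) \<in> borel_measurable iid"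
      using P.integrable_fst'[OF int_card] by (intro borel_measurable_integrable) simp
  qed simp
  also have "\<dots> = expected_num_killing n k" using S.prob_space by simp
  finally show ?thesis .
qed

lemma nn_integral_iid_prod:
  assumes I: "finite I" and f: "\<And>i. i \<in> I \<Longrightarrow> f i \<in> borel_measurable U"
  shows "(\<integral>\<^sup>+ y. (\<Prod>i\<in>I. f i (y i)) \<partial>iid) = (\<Prod>i\<in>I. integral\<^sup>N U (f i))"
proof -
  interpret product_prob_space "\<lambda>_. U" "UNIV :: nat set" ..
  have "(\<Prod>i\<in>I. integral\<^sup>N U (f i)) = (\<integral>\<^sup>+ y. (\<Prod>i\<in>I. f i (y i)) \<partial>Pi\<^sub>M I (\<lambda>_. U))"
    using assms by (rule product_nn_integral_prod[symmetric])
  also have "\<dots> = (\<integral>\<^sup>+ y. (\<Prod>i\<in>I. f i (y i)) \<partial>distr (Pi\<^sub>M UNIV (\<lambda>_. U)) (Pi\<^sub>M I (\<lambda>_. U)) (\<lambda>y. restrict y I))"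
    using distr_PiM_restrict_finite[OF I] by simp
  also have "\<dots> = (\<integral>\<^sup>+ y. (\<Prod>i\<in>I. f i (restrict y I i)) \<partial>Pi\<^sub>M UNIV (\<lambda>_. U))"
  proof (intro nn_integral_distr measurable_restrict_subset)
    have "(\<lambda>y. f i (y i)) \<in> borel_measurable (Pi\<^sub>M I (\<lambda>_. U))" if "i \<in> I" for i
      by (rule measurable_compose[OF measurable_component_singleton[OF that] f[OF that]])
    then show "(\<lambda>y. \<Prod>i\<in>I. f i (y i)) \<in> borel_measurable
        (distr (Pi\<^sub>M UNIV (\<lambda>_. U)) (Pi\<^sub>M I (\<lambda>_. U)) (\<lambda>y. restrict y I))"
      unfolding measurable_distr_eq1 by (rule borel_measurable_prod_ennreal)
  qed simp
  finally show ?thesis by (simp add: iid_def cong: prod.cong)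
qed

text \<open>
  Pairing two independent i.i.d. sequences entrywise gives i.i.d. pairs: on a box, Fubini splits
  the probability into a product over the coordinates, one variable at a time.
\<close>

lemma distr_zip_iid:
  assumes I: "finite I"
  shows "distr (iid \<Otimes>\<^sub>M iid) (\<Pi>\<^sub>M i\<in>I. U \<Otimes>\<^sub>M U) (\<lambda>w. \<lambda>i\<in>I. (fst w i, snd w i)) = (\<Pi>\<^sub>M i\<in>I. U \<Otimes>\<^sub>M U)"
proof -
  interpret UU: pair_prob_space U U ..
  interpret PS: product_sigma_finite "\<lambda>_ :: nat. U \<Otimes>\<^sub>M U" ..
  let ?f = "\<lambda>w. \<lambda>i\<in>I. (fst w i, snd w i :: real)"
  have cU: "(\<lambda>y. y i) \<in> measurable iid U" for i
    by (simp add: measurable_cong_sets[OF refl events_eq_borel])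
  have pt: "(\<lambda>w. (fst w i, snd w i)) \<in> measurable (iid \<Otimes>\<^sub>M iid) (U \<Otimes>\<^sub>M U)" for i
    by (intro measurable_Pair measurable_compose[OF measurable_fst cU] measurable_compose[OF measurable_snd cU])
  have f: "?f \<in> measurable (iid \<Otimes>\<^sub>M iid) (\<Pi>\<^sub>M i\<in>I. U \<Otimes>\<^sub>M U)"
    by (intro measurable_restrict pt)
  show ?thesis
  proof (rule PS.PiM_eqI[OF I])
    fix A assume A: "\<And>i. i \<in> I \<Longrightarrow> A i \<in> sets (U \<Otimes>\<^sub>M U)"
    have box: "Pi\<^sub>E I A \<in> sets (\<Pi>\<^sub>M i\<in>I. U \<Otimes>\<^sub>M U)"
      using A I by (intro sets_PiM_I_finite)
    have ind: "(\<lambda>z. indicator (A i) z :: ennreal) \<in> borel_measurable (U \<Otimes>\<^sub>M U)" if "i \<in> I" for i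
      using A[OF that] by (rule borel_measurable_indicator)
    have sect: "(\<lambda>t. indicator (A i) (s, t) :: ennreal) \<in> borel_measurable U" if "i \<in> I" for i s
      by (rule measurable_compose[OF _ ind[OF that]]) (auto simp: space_eq_univ)
    have "emeasure (distr (iid \<Otimes>\<^sub>M iid) (\<Pi>\<^sub>M i\<in>I. U \<Otimes>\<^sub>M U) ?f) (Pi\<^sub>E I A) =
        (\<integral>\<^sup>+ w. indicator (Pi\<^sub>E I A) (?f w) \<partial>(iid \<Otimes>\<^sub>M iid))"
      using nn_integral_distr[OF f, of "indicator (Pi\<^sub>E I A)"] box by simp
    also have "\<dots> = (\<integral>\<^sup>+ w. (\<Prod>i\<in>I. indicator (A i) (fst w i, snd w i)) \<partial>(iid \<Otimes>\<^sub>M iid))"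
      using I by (intro nn_integral_cong) (auto simp: indicator_def PiE_iff prod_zero_iff split: if_splits)
    also have "\<dots> = (\<integral>\<^sup>+ x. \<integral>\<^sup>+ y. (\<Prod>i\<in>I. indicator (A i) (x i, y i)) \<partial>iid \<partial>iid)"
      by (subst S.nn_integral_fst[symmetric])
         (auto intro!: borel_measurable_prod_ennreal measurable_compose[OF pt ind])
    also have "\<dots> = (\<integral>\<^sup>+ x. (\<Prod>i\<in>I. \<integral>\<^sup>+ t. indicator (A i) (x i, t) \<partial>U) \<partial>iid)"
      by (intro nn_integral_cong nn_integral_iid_prod I sect)
    also have "\<dots> = (\<Prod>i\<in>I. \<integral>\<^sup>+ s. \<integral>\<^sup>+ t. indicator (A i) (s, t) \<partial>U \<partial>U)"
      by (rule nn_integral_iid_prod[OF I, where f = "\<lambda>i s. \<integral>\<^sup>+ t. indicator (A i) (s, t) \<partial>U"])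
         (intro borel_measurable_nn_integral_fst ind)
    also have "\<dots> = (\<Prod>i\<in>I. emeasure (U \<Otimes>\<^sub>M U) (A i))"
      by (intro prod.cong refl) (simp only: nn_integral_fst[OF ind] nn_integral_indicator[OF A])
    finally show "emeasure (distr (iid \<Otimes>\<^sub>M iid) (\<Pi>\<^sub>M i\<in>I. U \<Otimes>\<^sub>M U) ?f) (Pi\<^sub>E I A) =
      (\<Prod>i\<in>I. emeasure (U \<Otimes>\<^sub>M U) (A i))" .
  qed simp
qed

text \<open>
  The event depends on the joint law of the first \<open>n\<close> points only, and that law is realised by
  two independent i.i.d. sequences of coordinates.
\<close>

lemma prob_K_eq:
  assumes M: "prob_space M"
    and indep: "prob_space.indep_vars M (\<lambda>_. borel) X {1..n}"
    and X: "\<And>i. i \<in> {1..n} \<Longrightarrow> distr M borel (X i) = U \<Otimes>\<^sub>M U"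
    and n: "n \<ge> 1"
  shows "measure M {\<omega> \<in> space M. K (\<lambda>i. X i \<omega>) n = int k} =
         P.prob {w. kills_exactly (fst w) (snd w) n k n}"
proof -
  interpret M: prob_space M by (rule M)
  let ?I = "{1..n}" and ?B = "\<Pi>\<^sub>M i\<in>{1..n}. (borel :: (real \<times> real) measure)"
  define W where "W = {z \<in> space ?B. kills_exactly (\<lambda>i. fst (z i)) (\<lambda>i. snd (z i)) n k n}"
  have nn: "n \<in> ?I" using n by simp
  have proj: "fst \<in> borel_measurable (borel :: (real \<times> real) measure)"
    "snd \<in> borel_measurable (borel :: (real \<times> real) measure)"
    by (intro borel_measurable_continuous_onI continuous_intros)+
  have "Measurable.pred ?B (\<lambda>z. kills_exactly (\<lambda>i. fst (z i)) (\<lambda>i. snd (z i)) n k n)"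
    by (rule pred_kills_exactly[OF nn]; rule measurable_compose[OF measurable_component_singleton _]) (auto intro: proj)
  then have W: "W \<in> sets ?B" by (simp add: W_def pred_def)
  have rv: "X i \<in> borel_measurable M" if "i \<in> ?I" for i
    using indep that unfolding M.indep_vars_def by blast
  have XI: "(\<lambda>\<omega>. \<lambda>i\<in>?I. X i \<omega>) \<in> measurable M ?B"
    by (intro measurable_restrict rv)
  have restr: "kills_exactly (\<lambda>i. fst (restrict z ?I i)) (\<lambda>i. snd (restrict z ?I i)) n k n \<longleftrightarrow>
      kills_exactly (\<lambda>i. fst (z i)) (\<lambda>i. snd (z i)) n k n" for z :: "nat \<Rightarrow> real \<times> real"
    by (rule kills_exactly_cong[OF _ _ nn]) (simp_all add: order_equiv_def)
  have sets_U: "sets (U \<Otimes>\<^sub>M U) = sets (borel :: (real \<times> real) measure)"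
    by (metis borel_prod events_eq_borel sets_pair_measure_cong)
  have sets_PU: "sets (\<Pi>\<^sub>M i\<in>?I. U \<Otimes>\<^sub>M U) = sets ?B"
    by (intro sets_PiM_cong refl sets_U)
  have zip: "(\<lambda>w. \<lambda>i\<in>?I. (fst w i, snd w i)) \<in> measurable (iid \<Otimes>\<^sub>M iid) ?B"
  proof (rule measurable_restrict)
    show "(\<lambda>w. (fst w i, snd w i)) \<in> borel_measurable (iid \<Otimes>\<^sub>M iid)" for i
      by (intro borel_measurable_Pair measurable_compose[OF measurable_fst] measurable_compose[OF measurable_snd] measurable_component)
  qed
  have "distr M ?B (\<lambda>\<omega>. \<lambda>i\<in>?I. X i \<omega>) = (\<Pi>\<^sub>M i\<in>?I. distr M borel (X i))"
    using indep nn rv by (subst M.indep_vars_iff_distr_eq_PiM'[symmetric]) auto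
  also have "\<dots> = (\<Pi>\<^sub>M i\<in>?I. U \<Otimes>\<^sub>M U)" by (intro PiM_cong refl X)
  also have "\<dots> = distr (iid \<Otimes>\<^sub>M iid) ?B (\<lambda>w. \<lambda>i\<in>?I. (fst w i, snd w i))"
    unfolding distr_cong[OF refl sets_PU[symmetric] refl]
    by (rule distr_zip_iid[symmetric]) simp
  finally have law: "distr M ?B (\<lambda>\<omega>. \<lambda>i\<in>?I. X i \<omega>) =
      distr (iid \<Otimes>\<^sub>M iid) ?B (\<lambda>w. \<lambda>i\<in>?I. (fst w i, snd w i))" .
  have "{\<omega> \<in> space M. K (\<lambda>i. X i \<omega>) n = int k} = (\<lambda>\<omega>. \<lambda>i\<in>?I. X i \<omega>) -` W \<inter> space M"
    using measurable_space[OF XI] restr[of "\<lambda>i. X i _"] by (auto simp only: W_def K_eq_iff[OF n])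
  then have "measure M {\<omega> \<in> space M. K (\<lambda>i. X i \<omega>) n = int k} = measure (distr M ?B (\<lambda>\<omega>. \<lambda>i\<in>?I. X i \<omega>)) W"
    using measure_distr[OF XI W] by simp
  also have "\<dots> = measure (iid \<Otimes>\<^sub>M iid) ((\<lambda>w. \<lambda>i\<in>?I. (fst w i, snd w i)) -` W \<inter> space (iid \<Otimes>\<^sub>M iid))"
    unfolding law by (rule measure_distr[OF zip W])
  also have "(\<lambda>w. \<lambda>i\<in>?I. (fst w i, snd w i)) -` W \<inter> space (iid \<Otimes>\<^sub>M iid) = {w. kills_exactly (fst w) (snd w) n k n}"
  proof (rule set_eqI)
    fix w :: "(nat \<Rightarrow> real) \<times> (nat \<Rightarrow> real)"
    show "w \<in> (\<lambda>w. \<lambda>i\<in>?I. (fst w i, snd w i)) -` W \<inter> space (iid \<Otimes>\<^sub>M iid) \<longleftrightarrow>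
        w \<in> {w. kills_exactly (fst w) (snd w) n k n}"
      using measurable_space[OF zip, of w] restr[of "\<lambda>i. (fst w i, snd w i)"]
      by (simp add: W_def space_pair_measure)
  qed
  finally show ?thesis .
qed

end

section \<open>Uniform points of the unit square\<close>

lemma atomless_uniform: "atomless_distribution (uniform_measure lborel {0<..<1})"
proof -
  interpret prob_space "uniform_measure lborel {0<..<1::real}"
    by (rule prob_space_uniform_measure) auto
  show ?thesis
  proof
    show "measure (uniform_measure lborel {0<..<1}) {x} = 0" for x :: real
      by (cases "x \<in> {0<..<1}") (auto simp: measure_def)
  qed simp
qed

lemma uniform_square:
  "uniform_measure lborel ({0<..<1::real} \<times> {0<..<1::real}) =
   uniform_measure lborel {0<..<1} \<Otimes>\<^sub>M uniform_measure lborel {0<..<1}"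
proof -
  let ?U = "uniform_measure lborel {0<..<1::real}"
  interpret atomless_distribution ?U by (rule atomless_uniform)
  have eq: "emeasure lborel (A \<times> B) = emeasure lborel A * emeasure lborel B"
    if "A \<in> sets borel" "B \<in> sets borel" for A B :: "real set"
    using that by (simp add: lborel.emeasure_pair_measure_Times flip: lborel_prod)
  show ?thesis
  proof (rule pair_measure_eqI[symmetric])
    show "sigma_finite_measure ?U" ..
    then show "sigma_finite_measure ?U" .
    have "sets (?U \<Otimes>\<^sub>M ?U) = sets (borel \<Otimes>\<^sub>M borel :: (real \<times> real) measure)"
      by (intro sets_pair_measure_cong) simp_all
    then show "sets (?U \<Otimes>\<^sub>M ?U) = sets (uniform_measure lborel ({0<..<1::real} \<times> {0<..<1::real}))"
      by (simp only: borel_prod sets_uniform_measure sets_lborel)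
    fix A B assume "A \<in> sets ?U" "B \<in> sets ?U"
    then have AB: "A \<in> sets borel" "B \<in> sets borel" by auto
    then show "emeasure ?U A * emeasure ?U B =
        emeasure (uniform_measure lborel ({0<..<1::real} \<times> {0<..<1::real})) (A \<times> B)"
      by (simp add: emeasure_uniform_measure Times_Int_Times eq divide_ennreal_def borel_Times)
  qed
qed

theorem theorem3p9:
  fixes M :: "'a measure" and X :: "nat \<Rightarrow> 'a \<Rightarrow> real \<times> real" and n k :: nat
  assumes "prob_space M"
    and "prob_space.indep_vars M (\<lambda>_. borel) X {1..}"
    and "\<And>i. i \<ge> 1 \<Longrightarrow>
           distr M borel (X i) = uniform_measure lborel ({0<..<1} \<times> {0<..<1})"
    and "n \<ge> 1"
  shows "\<bar>measure M {\<omega> \<in> space M. K (\<lambda>i. X i \<omega>) n = int k}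
          - (1 / 2 ^ (k + 1) * (1 / real n) * harm n
             - (real k - 1) * (1 / 2 ^ (k + 2)) * (1 / real n))\<bar>
         \<le> 1 / 2 * (1 / real n ^ 2)"
proof -
  interpret atomless_distribution "uniform_measure lborel {0<..<1}" by (rule atomless_uniform)
  interpret M: prob_space M by (rule assms(1))
  define p where "p = measure M {\<omega> \<in> space M. K (\<lambda>i. X i \<omega>) n = int k}"
  define a where "a = harm n / 2 ^ (k + 1) - (real k - 1) / 2 ^ (k + 2)"
  have "p = P.prob {w. kills_exactly (fst w) (snd w) n k n}"
    unfolding p_def
  proof (rule prob_K_eq[OF assms(1) _ _ assms(4)])
    show "M.indep_vars (\<lambda>_. borel) X {1..n}"
      using assms(2) by (rule M.indep_vars_subset) auto
  qed (use assms(3) in \<open>auto simp: uniform_square\<close>)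
  then have "real n * p = expected_num_killing n k"
    using prob_kills_exactly[OF assms(4)] by simp
  then have "\<bar>real n * p - a\<bar> \<le> 1 / (4 * real n)"
    using expected_num_killing_bound[OF assms(4), of k] by (simp add: a_def)
  moreover have "real n * p - a = real n * (p - a / real n)"
    using assms(4) by (simp add: field_simps)
  ultimately have "real n * \<bar>p - a / real n\<bar> \<le> 1 / (4 * real n)"
    by (simp add: abs_mult)
  then have "\<bar>p - a / real n\<bar> \<le> 1 / 4 * (1 / real n ^ 2)"
    using assms(4) by (simp add: field_simps power2_eq_square)
  also have "\<dots> \<le> 1 / 2 * (1 / real n ^ 2)" by (intro mult_right_mono) simp_all
  also have "a / real n = 1 / 2 ^ (k + 1) * (1 / real n) * harm n
             - (real k - 1) * (1 / 2 ^ (k + 2)) * (1 / real n)"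
    by (simp add: a_def diff_divide_distrib)
  finally show ?thesis by (simp add: p_def)
qed

end
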